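(* Let $(X,\mathcal{X})$ be a large scale space and let $G$ be a finite group acting on $X$ by coarse equivalences. Let $q: X\to X/G$ be the quotient map onto the orbit space, and equip $X/G$ with the large scale structure $q(\mathcal{X})=\{q(\mathcal{U})\mid \mathcal{U}\in\mathcal{X}\}$, where $q(\mathcal{U})=\{q(U)\mid U\in\mathcal{U}\}$. Then the natural map $p: X_G\to X/G$ (equal to $q$ on underlying sets) is a coarse equivalence.
   Context: For $B\subseteq X$ and a family $\mathcal{U}$ of subsets of $X$, the star $\mathrm{st}(B,\mathcal{U})$ is the union of the elements of $\mathcal{U}$ that intersect $B$; for families, $\mathrm{st}(\mathcal{B},\mathcal{U})=\{\mathrm{st}(B,\mathcal{U})\mid B\in\mathcal{B}\}$. A large scale structure $\mathcal{L}$ on a set $X$ is a nonempty set of families of subsets of $X$ (called the uniformly bounded families) such that: (1) if $\mathcal{B}_1\in\mathcal{L}$ and each element of $\mathcal{B}_2$ consisting of more than one point is contained in some element of $\mathcal{B}_1$, then $\mathcal{B}_2\in\mathcal{L}$; (2) $\mathcal{B}_1,\mathcal{B}_2\in\mathcal{L}$ implies $\mathrm{st}(\mathcal{B}_1,\mathcal{B}_2)\in\mathcal{L}$. A large scale space is a set with a large scale structure. The large scale structure generated by a collection of families is the smallest large scale structure containing that collection. A map $f:X\to Y$ of large scale spaces is large scale continuous if $f(\mathcal{U})=\{f(U)\mid U\in\mathcal{U}\}$ is uniformly bounded for every uniformly bounded $\mathcal{U}$ in $X$. A large scale continuous map $f$ is coarsely surjective if $Y\subseteq \mathrm{st}(f(X),\mathcal{V})$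 for some uniformly bounded family $\mathcal{V}$ in $Y$; a coarse embedding if $f^{-1}(\mathcal{V})=\{f^{-1}(V)\mid V\in\mathcal{V}\}$ is uniformly bounded in $X$ for every uniformly bounded $\mathcal{V}$ in $Y$; a coarse equivalence if it is both. An action of a group $G$ on $X$ by coarse equivalences is an action of $G$ on the underlying set of $X$ such that every $g\in G$ acts as a large scale continuous map. $X_G$ denotes the set $X$ with the large scale structure generated by $\mathcal{X}$ together with all families $\{\{x,gx\}\mid x\in X\}$, $g\in G$. When $G$ is finite, $q(\mathcal{X})$ is indeed a large scale structure on $X/G$. *)

theory Defs
  imports "HOL-Algebra.Group_Action"
begin

text \<open>
  A large scale space is given by a carrier set \<open>X\<close>, which may be a proper subset of its type,
  together with a set of families of subsets of \<open>X\<close>, the uniformly bounded families.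
\<close>

definition star :: "'a set \<Rightarrow> 'a set set \<Rightarrow> 'a set" where
  "star B \<U> = \<Union> {U \<in> \<U>. U \<inter> B \<noteq> {}}"

definition star_family :: "'a set set \<Rightarrow> 'a set set \<Rightarrow> 'a set set" where
  "star_family \<B> \<U> = {star B \<U> | B. B \<in> \<B>}"

definition large_scale_structure :: "'a set \<Rightarrow> 'a set set set \<Rightarrow> bool" where
  "large_scale_structure X \<L> \<longleftrightarrow>
     \<L> \<subseteq> Pow (Pow X) \<and> \<L> \<noteq> {} \<and>
     (\<forall>\<B>1 \<in> \<L>. \<forall>\<B>2 \<subseteq> Pow X.
        (\<forall>B \<in> \<B>2. (\<exists>x \<in> B. \<exists>y \<in> B. x \<noteq> y) \<longrightarrow> (\<exists>A \<in> \<B>1. B \<subseteq> A)) \<longrightarrow> \<B>2 \<in> \<L>) \<and>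
     (\<forall>\<B>1 \<in> \<L>. \<forall>\<B>2 \<in> \<L>. star_family \<B>1 \<B>2 \<in> \<L>)"

definition generated_structure :: "'a set \<Rightarrow> 'a set set set \<Rightarrow> 'a set set set" where
  "generated_structure X \<C> = \<Inter> {\<L>. large_scale_structure X \<L> \<and> \<C> \<subseteq> \<L>}"

definition image_family :: "('a \<Rightarrow> 'b) \<Rightarrow> 'a set set \<Rightarrow> 'b set set" where
  "image_family f \<U> = {f ` U | U. U \<in> \<U>}"

definition vimage_family :: "'a set \<Rightarrow> ('a \<Rightarrow> 'b) \<Rightarrow> 'b set set \<Rightarrow> 'a set set" where
  "vimage_family X f \<V> = {f -` V \<inter> X | V. V \<in> \<V>}"

text \<open>
  Continuity includes that source and target are large scale spaces and that \<open>f\<close> maps one carrier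
  to the other. Hence so do the notions below, which are only defined for continuous maps.
\<close>

definition large_scale_continuous ::
    "'a set \<Rightarrow> 'a set set set \<Rightarrow> 'b set \<Rightarrow> 'b set set set \<Rightarrow> ('a \<Rightarrow> 'b) \<Rightarrow> bool" where
  "large_scale_continuous X \<X> Y \<Y> f \<longleftrightarrow>
     large_scale_structure X \<X> \<and> large_scale_structure Y \<Y> \<and> f \<in> X \<rightarrow> Y \<and>
     (\<forall>\<U> \<in> \<X>. image_family f \<U> \<in> \<Y>)"

definition coarsely_surjective ::
    "'a set \<Rightarrow> 'a set set set \<Rightarrow> 'b set \<Rightarrow> 'b set set set \<Rightarrow> ('a \<Rightarrow> 'b) \<Rightarrow> bool" where
  "coarsely_surjective X \<X> Y \<Y> f \<longleftrightarrow>
     large_scale_continuous X \<X> Y \<Y> f \<and> (\<exists>\<V> \<in> \<Y>. Y \<subseteq> star (f ` X) \<V>)"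

definition coarse_embedding ::
    "'a set \<Rightarrow> 'a set set set \<Rightarrow> 'b set \<Rightarrow> 'b set set set \<Rightarrow> ('a \<Rightarrow> 'b) \<Rightarrow> bool" where
  "coarse_embedding X \<X> Y \<Y> f \<longleftrightarrow>
     large_scale_continuous X \<X> Y \<Y> f \<and> (\<forall>\<V> \<in> \<Y>. vimage_family X f \<V> \<in> \<X>)"

definition coarse_equivalence ::
    "'a set \<Rightarrow> 'a set set set \<Rightarrow> 'b set \<Rightarrow> 'b set set set \<Rightarrow> ('a \<Rightarrow> 'b) \<Rightarrow> bool" where
  "coarse_equivalence X \<X> Y \<Y> f \<longleftrightarrow>
     coarsely_surjective X \<X> Y \<Y> f \<and> coarse_embedding X \<X> Y \<Y> f"

text \<open>
  Only continuity is demanded of each \<open>\<phi> g\<close>: its inverse on \<open>X\<close> is the action of \<open>inv g\<close>, so it is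
  then automatically a coarse equivalence.
\<close>

definition acts_by_coarse_equivalences ::
    "('g, 'm) monoid_scheme \<Rightarrow> 'a set \<Rightarrow> 'a set set set \<Rightarrow> ('g \<Rightarrow> 'a \<Rightarrow> 'a) \<Rightarrow> bool" where
  "acts_by_coarse_equivalences G X \<X> \<phi> \<longleftrightarrow>
     group_action G X \<phi> \<and> (\<forall>g \<in> carrier G. large_scale_continuous X \<X> X \<X> (\<phi> g))"

text \<open>The large scale structure of \<open>X\<^sub>G\<close>.\<close>

definition action_structure ::
    "('g, 'm) monoid_scheme \<Rightarrow> 'a set \<Rightarrow> 'a set set set \<Rightarrow> ('g \<Rightarrow> 'a \<Rightarrow> 'a) \<Rightarrow> 'a set set set" where
  "action_structure G X \<X> \<phi> =
     generated_structure X (\<X> \<union> {{{x, \<phi> g x} | x. x \<in> X} | g. g \<in> carrier G})"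

text \<open>
  The orbit space \<open>X/G\<close> is \<^term>\<open>orbits G X \<phi>\<close>, and the quotient map \<open>q\<close> is \<^term>\<open>orbit G \<phi>\<close>.
\<close>

definition quotient_structure ::
    "('g, 'm) monoid_scheme \<Rightarrow> 'a set set set \<Rightarrow> ('g \<Rightarrow> 'a \<Rightarrow> 'a) \<Rightarrow> 'a set set set set" where
  "quotient_structure G \<X> \<phi> = {image_family (orbit G \<phi>) \<U> | \<U>. \<U> \<in> \<X>}"

end

(*
Let GU be the union of the translates of U by the elements of G. Since G is finite, finite unions
of uniformly bounded families being uniformly bounded makes the translates of a uniformly bounded
family by all of G uniformly bounded together; this bounds stars in X/G by images of stars in X,
so that q(\<X>) is closed under stars. Pulling q(\<X>) back along q yields a large scale structure on
X that contains \<X> and the families {x, gx}, whence p is continuous. Finally the preimage of q(U)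
is GU, which lies in the star of U with respect to the family of all pairs {x, gx}.
*)

theory Submission
  imports Defs
begin

section \<open>Large scale structures\<close>

lemma mem_star: "x \<in> star B \<U> \<longleftrightarrow> (\<exists>U\<in>\<U>. x \<in> U \<and> U \<inter> B \<noteq> {})"
  by (auto simp: star_def)

lemma star_subset: "\<U> \<subseteq> Pow X \<Longrightarrow> star B \<U> \<subseteq> X"
  by (auto simp: star_def)

lemma star_family_eq: "star_family \<B> \<U> = (\<lambda>B. star B \<U>) ` \<B>"
  by (auto simp: star_family_def)

lemma image_family_eq: "image_family f \<U> = (\<lambda>U. f ` U) ` \<U>"
  by (auto simp: image_family_def)

lemma vimage_family_eq: "vimage_family X f \<V> = (\<lambda>V. f -` V \<inter> X) ` \<V>"
  by (auto simp: vimage_family_def)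

lemma large_scale_structureI:
  assumes "\<L> \<subseteq> Pow (Pow X)" and "\<L> \<noteq> {}"
    and "\<And>\<A> \<B>. \<A> \<in> \<L> \<Longrightarrow> \<B> \<subseteq> Pow X \<Longrightarrow>
           (\<And>B x y. B \<in> \<B> \<Longrightarrow> x \<in> B \<Longrightarrow> y \<in> B \<Longrightarrow> x \<noteq> y \<Longrightarrow> \<exists>A\<in>\<A>. B \<subseteq> A) \<Longrightarrow> \<B> \<in> \<L>"
    and "\<And>\<A> \<B>. \<A> \<in> \<L> \<Longrightarrow> \<B> \<in> \<L> \<Longrightarrow> star_family \<A> \<B> \<in> \<L>"
  shows "large_scale_structure X \<L>"
  unfolding large_scale_structure_def
proof (intro conjI ballI allI impI)
  fix \<A> \<B>
  assume *: "\<A> \<in> \<L>" "\<B> \<subseteq> Pow X" "\<forall>B\<in>\<B>. (\<exists>x\<in>B. \<exists>y\<in>B. x \<noteq> y) \<longrightarrow> (\<exists>A\<in>\<A>. B \<subseteq> A)"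
  have "\<exists>A\<in>\<A>. B \<subseteq> A" if "B \<in> \<B>" "x \<in> B" "y \<in> B" "x \<noteq> y" for B x y
    using *(3) that by blast
  from assms(3)[OF *(1,2) this] show "\<B> \<in> \<L>" .
qed (use assms(1,2,4) in auto)

section \<open>Closure properties of a single large scale structure\<close>

context
  fixes X :: "'a set" and \<L>
  assumes lss: "large_scale_structure X \<L>"
begin

lemma lss_subset: "\<A> \<in> \<L> \<Longrightarrow> \<A> \<subseteq> Pow X"
  using lss unfolding large_scale_structure_def by blast

lemma lss_nonempty: "\<L> \<noteq> {}"
  using lss unfolding large_scale_structure_def by blast

lemma lss_refine:
  assumes "\<A> \<in> \<L>" "\<B> \<subseteq> Pow X"
    and "\<And>B x y. B \<in> \<B> \<Longrightarrow> x \<in> B \<Longrightarrow> y \<in> B \<Longrightarrow> x \<noteq> y \<Longrightarrow> \<exists>A\<in>\<A>. B \<subseteq> A"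
  shows "\<B> \<in> \<L>"
proof -
  have "\<forall>B\<in>\<B>. (\<exists>x\<in>B. \<exists>y\<in>B. x \<noteq> y) \<longrightarrow> (\<exists>A\<in>\<A>. B \<subseteq> A)"
    using assms(3) by blast
  with assms(1,2) show ?thesis
    using lss unfolding large_scale_structure_def by blast
qed

lemma lss_star: "\<A> \<in> \<L> \<Longrightarrow> \<B> \<in> \<L> \<Longrightarrow> star_family \<A> \<B> \<in> \<L>"
  using lss unfolding large_scale_structure_def by blast

lemma lss_empty: "{} \<in> \<L>"
proof -
  obtain \<A> where "\<A> \<in> \<L>" using lss_nonempty by blast
  then show ?thesis by (rule lss_refine) auto
qed

text \<open>The refinement axiom puts no condition on one-point sets, so singletons come for free.
  They turn any uniformly bounded family into a cover of \<open>X\<close>, after which stars contain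
  the sets they are taken of.\<close>

lemma lss_Un_singletons:
  assumes "\<A> \<in> \<L>"
  shows "\<A> \<union> (\<lambda>x. {x}) ` X \<in> \<L>"
  using assms by (rule lss_refine) (use lss_subset[OF assms] in auto)

lemma lss_singletons: "(\<lambda>x. {x}) ` X \<in> \<L>"
  using lss_Un_singletons[OF lss_empty] by simp

text \<open>Once both families are enlarged by all singletons, a single star family refines both: a
  member of \<open>\<A>\<close> lies in its own star, and a member of \<open>\<B>\<close> lies in
  the star of any of its points.\<close>

lemma lss_Un:
  assumes "\<A> \<in> \<L>" "\<B> \<in> \<L>"
  shows "\<A> \<union> \<B> \<in> \<L>"
proof -
  let ?S = "(\<lambda>x. {x}) ` X"
  have sub: "\<A> \<subseteq> Pow X" "\<B> \<subseteq> Pow X"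
    using assms lss_subset by auto
  show ?thesis
  proof (rule lss_refine[OF lss_star[OF lss_Un_singletons[OF assms(1)] lss_Un_singletons[OF assms(2)]]])
    show "\<A> \<union> \<B> \<subseteq> Pow X" using sub by auto
    fix C x y assume C: "C \<in> \<A> \<union> \<B>" and x: "x \<in> C"
    then have xX: "x \<in> X" using sub by auto
    show "\<exists>D\<in>star_family (\<A> \<union> ?S) (\<B> \<union> ?S). C \<subseteq> D"
    proof (cases "C \<in> \<A>")
      case True
      have "C \<subseteq> star C (\<B> \<union> ?S)"
        using sub True by (fastforce simp: mem_star)
      with True show ?thesis by (auto simp: star_family_eq)
    next
      case False
      then have "C \<subseteq> star {x} (\<B> \<union> ?S)"
        using C x by (auto simp: mem_star)
      with xX show ?thesis by (auto simp: star_family_eq)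
    qed
  qed
qed

text \<open>Finiteness of the group enters through this closure property, applied to the translates
  of a family and to the families of pairs {x, gx}.\<close>

lemma lss_UN:
  assumes "finite I" "\<And>i. i \<in> I \<Longrightarrow> \<A> i \<in> \<L>"
  shows "(\<Union>i\<in>I. \<A> i) \<in> \<L>"
  using assms by induction (auto simp: lss_empty lss_Un)

end

section \<open>Intersections, generated structures and pullbacks\<close>

lemma large_scale_structure_Inter:
  assumes "S \<noteq> {}" and S: "\<And>\<L>. \<L> \<in> S \<Longrightarrow> large_scale_structure X \<L>"
  shows "large_scale_structure X (\<Inter>S)"
proof (rule large_scale_structureI)
  show "\<Inter>S \<subseteq> Pow (Pow X)"
  proof
    fix \<A> assume "\<A> \<in> \<Inter>S"
    moreover obtain \<L> where "\<L> \<in> S" using assms(1) by blast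
    ultimately show "\<A> \<in> Pow (Pow X)"
      using lss_subset[OF S] by blast
  qed
  show "\<Inter>S \<noteq> {}"
    using lss_empty[OF S] by blast
next
  fix \<A> \<B>
  assume *: "\<A> \<in> \<Inter>S" "\<B> \<subseteq> Pow X"
    "\<And>B x y. B \<in> \<B> \<Longrightarrow> x \<in> B \<Longrightarrow> y \<in> B \<Longrightarrow> x \<noteq> y \<Longrightarrow> \<exists>A\<in>\<A>. B \<subseteq> A"
  show "\<B> \<in> \<Inter>S"
  proof
    fix \<L> assume L: "\<L> \<in> S"
    then have "\<A> \<in> \<L>" using *(1) by blast
    then show "\<B> \<in> \<L>" by (rule lss_refine[OF S[OF L] _ *(2,3)])
  qed
next
  fix \<A> \<B> assume "\<A> \<in> \<Inter>S" "\<B> \<in> \<Inter>S"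
  then show "star_family \<A> \<B> \<in> \<Inter>S"
    using lss_star[OF S] by blast
qed

text \<open>This largest structure ensures that the intersection defining a generated structure is
  taken over a nonempty set.\<close>

lemma large_scale_structure_Pow: "large_scale_structure X (Pow (Pow X))"
proof (rule large_scale_structureI)
  fix \<A> \<B> assume "\<B> \<in> Pow (Pow X)"
  then show "star_family \<A> \<B> \<in> Pow (Pow X)"
    using star_subset[of \<B> X] by (auto simp: star_family_eq)
qed auto

lemma generated_structure_lss:
  assumes "\<C> \<subseteq> Pow (Pow X)"
  shows "large_scale_structure X (generated_structure X \<C>)"
  unfolding generated_structure_def
proof (rule large_scale_structure_Inter)
  have "Pow (Pow X) \<in> {\<L>. large_scale_structure X \<L> \<and> \<C> \<subseteq> \<L>}"
    using assms large_scale_structure_Pow by simp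
  then show "{\<L>. large_scale_structure X \<L> \<and> \<C> \<subseteq> \<L>} \<noteq> {}"
    by (metis empty_iff)
qed simp

lemma generated_structure_superset: "\<C> \<subseteq> generated_structure X \<C>"
  by (auto simp: generated_structure_def)

lemma generated_structure_least:
  "large_scale_structure X \<L> \<Longrightarrow> \<C> \<subseteq> \<L> \<Longrightarrow> generated_structure X \<C> \<subseteq> \<L>"
  by (auto simp: generated_structure_def)

text \<open>Images respect inclusions, and the image of st(A, \<B>) lies in the star of f(A) with
  respect to f(\<B>). To prove a map out of a generated structure continuous, it therefore suffices
  to check the generators.\<close>

lemma large_scale_structure_pullback:
  assumes Y: "large_scale_structure Y \<Y>" and f: "f \<in> X \<rightarrow> Y"
  shows "large_scale_structure X {\<U>. \<U> \<subseteq> Pow X \<and> image_family f \<U> \<in> \<Y>}"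
    (is "large_scale_structure X ?L")
proof (rule large_scale_structureI)
  show "?L \<subseteq> Pow (Pow X)" by auto
  have "{} \<in> ?L" using lss_empty[OF Y] by (simp add: image_family_eq)
  then show "?L \<noteq> {}" by blast
next
  fix \<A> \<B>
  assume A: "\<A> \<in> ?L" and B: "\<B> \<subseteq> Pow X"
    and ref: "\<And>B x y. B \<in> \<B> \<Longrightarrow> x \<in> B \<Longrightarrow> y \<in> B \<Longrightarrow> x \<noteq> y \<Longrightarrow> \<exists>A\<in>\<A>. B \<subseteq> A"
  have "image_family f \<B> \<in> \<Y>"
  proof (rule lss_refine[OF Y])
    show "image_family f \<A> \<in> \<Y>" using A by auto
    show "image_family f \<B> \<subseteq> Pow Y" using B f by (auto simp: image_family_eq)
    fix C u v assume "C \<in> image_family f \<B>" "u \<in> C" "v \<in> C" "u \<noteq> v"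
    then obtain B x y where "B \<in> \<B>" "C = f ` B" "x \<in> B" "y \<in> B" "x \<noteq> y"
      by (auto simp: image_family_eq)
    with ref[of B x y] show "\<exists>A\<in>image_family f \<A>. C \<subseteq> A"
      by (auto simp: image_family_eq)
  qed
  with B show "\<B> \<in> ?L" by simp
next
  fix \<A> \<B>
  assume A: "\<A> \<in> ?L" and B: "\<B> \<in> ?L"
  have sub: "star_family \<A> \<B> \<subseteq> Pow X"
    using B star_subset[of \<B> X] by (auto simp: star_family_eq)
  have "image_family f (star_family \<A> \<B>) \<in> \<Y>"
  proof (rule lss_refine[OF Y])
    show "star_family (image_family f \<A>) (image_family f \<B>) \<in> \<Y>"
      using lss_star[OF Y] A B by auto
    show "image_family f (star_family \<A> \<B>) \<subseteq> Pow Y"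
      using sub f by (auto simp: image_family_eq)
    fix C assume "C \<in> image_family f (star_family \<A> \<B>)"
    then obtain A where A: "A \<in> \<A>" "C = f ` star A \<B>"
      by (auto simp: image_family_eq star_family_eq)
    have "f ` star A \<B> \<subseteq> star (f ` A) (image_family f \<B>)"
    proof
      fix z assume "z \<in> f ` star A \<B>"
      then obtain b where b: "b \<in> star A \<B>" "z = f b" by blast
      then obtain B where "B \<in> \<B>" "b \<in> B" "B \<inter> A \<noteq> {}"
        unfolding mem_star by blast
      with b show "z \<in> star (f ` A) (image_family f \<B>)"
        by (auto simp: mem_star image_family_eq intro!: bexI[of _ B])
    qed
    with A show "\<exists>D\<in>star_family (image_family f \<A>) (image_family f \<B>). C \<subseteq> D"
      by (auto simp: image_family_eq star_family_eq)
  qed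
  with sub show "star_family \<A> \<B> \<in> ?L" by simp
qed

section \<open>Orbit spaces\<close>

lemma (in group_action) orbit_eq_iff:
  assumes "x \<in> E" "y \<in> E"
  shows "orbit G \<phi> x = orbit G \<phi> y \<longleftrightarrow> (\<exists>g\<in>carrier G. y = \<phi> g x)"
proof
  assume "orbit G \<phi> x = orbit G \<phi> y"
  then have "y \<in> orbit G \<phi> x" using orbit_refl assms by simp
  then show "\<exists>g\<in>carrier G. y = \<phi> g x" by (auto simp: orbit_def)
next
  assume "\<exists>g\<in>carrier G. y = \<phi> g x"
  then have y: "y \<in> orbit G \<phi> x" by (auto simp: orbit_def)
  \<comment> \<open>Transitivity of orbits is available only for points of \<open>E\<close>, so both
    inclusions below need orbits to stay inside \<open>E\<close>.\<close>
  have sub: "orbit G \<phi> z \<subseteq> E" if "z \<in> E" for z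
    using that element_image by (auto simp: orbit_def)
  have x: "x \<in> orbit G \<phi> y"
    using orbit_sym assms y by blast
  show "orbit G \<phi> x = orbit G \<phi> y"
    using sub orbit_trans[OF assms(1,2) _ y] orbit_trans[OF assms(2,1) _ x] assms by blast
qed

section \<open>The structures on \<open>X\<close> and on the orbit space\<close>

lemma action_generators_subset:
  assumes "large_scale_structure X \<X>" and "group_action G X \<phi>"
  shows "\<X> \<union> {{{x, \<phi> g x} | x. x \<in> X} | g. g \<in> carrier G} \<subseteq> Pow (Pow X)"
proof -
  have "\<phi> g x \<in> X" if "g \<in> carrier G" "x \<in> X" for g x
    using group_action.element_image[OF assms(2) that refl] .
  then have "{{x, \<phi> g x} | x. x \<in> X} \<subseteq> Pow X" if "g \<in> carrier G" for g
    using that by auto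
  then show ?thesis
    using lss_subset[OF assms(1)] by blast
qed

lemma action_structure_lss:
  assumes "large_scale_structure X \<X>" and "group_action G X \<phi>"
  shows "large_scale_structure X (action_structure G X \<X> \<phi>)"
  unfolding action_structure_def
  by (rule generated_structure_lss[OF action_generators_subset[OF assms]])

lemma quotient_structure_lss:
  assumes X: "large_scale_structure X \<X>" and fin: "finite (carrier G)"
    and act: "acts_by_coarse_equivalences G X \<X> \<phi>"
  shows "large_scale_structure (orbits G X \<phi>) (quotient_structure G \<X> \<phi>)"
proof -
  interpret group_action G X \<phi>
    using act by (simp add: acts_by_coarse_equivalences_def)
  let ?q = "orbit G \<phi>"
  have orbits: "orbits G X \<phi> = ?q ` X"
    by (auto simp: orbits_def)
  have quotient: "quotient_structure G \<X> \<phi> = image_family ?q ` \<X>"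
    by (auto simp: quotient_structure_def)
  note XD = lss_subset[OF X]
  \<comment> \<open>Members of the quotient structure are exact image families, so bounding each
    \<open>B\<close> by some q(A) is not enough: \<open>B\<close> must be lifted to a set with image
    exactly \<open>B\<close>. Both axioms below reduce to this fact.\<close>
  have refine: "\<B> \<in> image_family ?q ` \<X>"
    if A: "\<A> \<in> \<X>" and B: "\<B> \<subseteq> Pow (?q ` X)"
      and ref: "\<And>B x y. B \<in> \<B> \<Longrightarrow> x \<in> B \<Longrightarrow> y \<in> B \<Longrightarrow> x \<noteq> y \<Longrightarrow> \<exists>A\<in>\<A>. B \<subseteq> ?q ` A"
    for \<A> \<B>
  proof -
    have "\<exists>C\<subseteq>X. ?q ` C = B \<and> (\<forall>x\<in>C. \<forall>y\<in>C. x \<noteq> y \<longrightarrow> (\<exists>A\<in>\<A>. C \<subseteq> A))"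
      if "B \<in> \<B>" for B
    proof (cases "\<exists>x\<in>B. \<exists>y\<in>B. x \<noteq> y")
      case True
      with ref that obtain A where "A \<in> \<A>" "B \<subseteq> ?q ` A" by blast
      \<comment> \<open>Cutting \<open>A\<close> down to the points over \<open>B\<close> makes the
        image exact.\<close>
      then show ?thesis
        using XD[OF A] by (intro exI[of _ "A \<inter> ?q -` B"]) auto
    next
      case False
      show ?thesis
      proof (cases "B = {}")
        case True
        then show ?thesis by auto
      next
        case nonempty: False
        with False obtain b where "B = {b}" by blast
        with that B obtain x where "x \<in> X" "B = {?q x}" by auto
        \<comment> \<open>A one-point \<open>B\<close> need not lie in any q(A), so one point is
          chosen as the lift instead of the whole fibre; the refinement condition is then
          vacuous.\<close>
        then show ?thesis by (intro exI[of _ "{x}"]) auto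
      qed
    qed
    then obtain h where h: "\<And>B. B \<in> \<B> \<Longrightarrow> h B \<subseteq> X" "\<And>B. B \<in> \<B> \<Longrightarrow> ?q ` h B = B"
      "\<And>B x y. B \<in> \<B> \<Longrightarrow> x \<in> h B \<Longrightarrow> y \<in> h B \<Longrightarrow> x \<noteq> y \<Longrightarrow> \<exists>A\<in>\<A>. h B \<subseteq> A"
      by metis
    have "h ` \<B> \<in> \<X>"
      by (rule lss_refine[OF X A]) (use h(1,3) in auto)
    moreover have "image_family ?q (h ` \<B>) = \<B>"
      using h(2) by (simp add: image_family_eq image_image)
    ultimately show ?thesis by (metis image_eqI)
  qed
  show ?thesis
    unfolding orbits quotient
  proof (rule large_scale_structureI)
    show "image_family ?q ` \<X> \<subseteq> Pow (Pow (?q ` X))"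
    proof
      fix \<V> assume "\<V> \<in> image_family ?q ` \<X>"
      then obtain \<U> where "\<U> \<in> \<X>" "\<V> = image_family ?q \<U>" by blast
      with XD[of \<U>] show "\<V> \<in> Pow (Pow (?q ` X))"
        by (auto simp: image_family_eq)
    qed
    show "image_family ?q ` \<X> \<noteq> {}"
      using lss_nonempty[OF X] by blast
  next
    fix \<A> \<B>
    assume "\<A> \<in> image_family ?q ` \<X>" and B: "\<B> \<subseteq> Pow (?q ` X)"
      and ref: "\<And>B x y. B \<in> \<B> \<Longrightarrow> x \<in> B \<Longrightarrow> y \<in> B \<Longrightarrow> x \<noteq> y \<Longrightarrow> \<exists>A\<in>\<A>. B \<subseteq> A"
    then obtain \<U> where U: "\<U> \<in> \<X>" "\<A> = image_family ?q \<U>" by blast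
    show "\<B> \<in> image_family ?q ` \<X>"
    proof (rule refine[OF U(1) B])
      fix B x y assume "B \<in> \<B>" "x \<in> B" "y \<in> B" "x \<noteq> y"
      from ref[OF this] show "\<exists>A\<in>\<U>. B \<subseteq> ?q ` A"
        by (simp add: U(2) image_family_eq)
    qed
  next
    fix \<A> \<B>
    assume "\<A> \<in> image_family ?q ` \<X>" "\<B> \<in> image_family ?q ` \<X>"
    then obtain \<U> \<V> where U: "\<U> \<in> \<X>" "\<A> = image_family ?q \<U>"
      and V: "\<V> \<in> \<X>" "\<B> = image_family ?q \<V>" by blast
    \<comment> \<open>A member of \<open>\<V>\<close> whose image meets q(U) need not itself meet
      \<open>U\<close>, but one of its translates does; hence stars are taken with respect to all
      translates.\<close>
    let ?W = "\<Union>g\<in>carrier G. image_family (\<phi> g) \<V>"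
    have W: "?W \<in> \<X>"
      using act V(1) by (intro lss_UN[OF X fin])
        (auto simp: acts_by_coarse_equivalences_def large_scale_continuous_def)
    have key: "star (?q ` U) \<B> \<subseteq> ?q ` star U ?W" if UU: "U \<in> \<U>" for U
    proof
      fix z assume "z \<in> star (?q ` U) \<B>"
      then obtain A v u w where A: "A \<in> \<V>" "v \<in> A" "z = ?q v" "u \<in> U" "w \<in> A" "?q w = ?q u"
        by (auto simp: mem_star V(2) image_family_eq)
      have X: "v \<in> X" "w \<in> X" "u \<in> X"
        using A UU XD[OF U(1)] XD[OF V(1)] by auto
      \<comment> \<open>Moving \<open>w\<close> onto \<open>u\<close> makes the translate of
        \<open>A\<close> meet \<open>U\<close>. That translate contains \<open>\<phi> g v\<close>,
        which lies over the same point \<open>z\<close> as \<open>v\<close>.\<close>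
      obtain g where g: "g \<in> carrier G" "u = \<phi> g w"
        using orbit_eq_iff[OF X(2,3)] A by blast
      have "\<phi> g v \<in> star U ?W"
        unfolding mem_star
        by (rule bexI[of _ "\<phi> g ` A"]) (use A g in \<open>auto simp: image_family_eq\<close>)
      moreover have "z = ?q (\<phi> g v)"
        using orbit_eq_iff[OF X(1) element_image[OF g(1) X(1) refl]] g A by blast
      ultimately show "z \<in> ?q ` star U ?W" by blast
    qed
    show "star_family \<A> \<B> \<in> image_family ?q ` \<X>"
    proof (rule refine[OF lss_star[OF X U(1) W]])
      show "star_family \<A> \<B> \<subseteq> Pow (?q ` X)"
      proof -
        have "\<B> \<subseteq> Pow (?q ` X)"
          using XD[OF V(1)] by (auto simp: V(2) image_family_eq)
        from star_subset[OF this] show ?thesis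
          by (auto simp: star_family_eq)
      qed
      fix B assume "B \<in> star_family \<A> \<B>"
      then obtain U where "U \<in> \<U>" "B = star (?q ` U) \<B>"
        by (auto simp: star_family_eq U(2) image_family_eq)
      with key[of U] show "\<exists>A\<in>star_family \<U> ?W. B \<subseteq> ?q ` A"
        by (auto simp: star_family_eq)
    qed
  qed
qed

section \<open>Continuity, coarse surjectivity and the embedding property of p\<close>

theorem proposition3p6:
  fixes G :: "('g, 'm) monoid_scheme"
    and X :: "'a set"
    and \<X> :: "'a set set set"
    and \<phi> :: "'g \<Rightarrow> 'a \<Rightarrow> 'a"
  assumes "large_scale_structure X \<X>"
    and "group G"
    and "finite (carrier G)"
    and "acts_by_coarse_equivalences G X \<X> \<phi>"
  shows "coarse_equivalence X (action_structure G X \<X> \<phi>)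
           (orbits G X \<phi>) (quotient_structure G \<X> \<phi>) (orbit G \<phi>)"
proof -
  interpret group_action G X \<phi>
    using assms(4) by (simp add: acts_by_coarse_equivalences_def)
  let ?q = "orbit G \<phi>" and ?Q = "quotient_structure G \<X> \<phi>" and ?A = "action_structure G X \<X> \<phi>"
  let ?E = "\<lambda>g. (\<lambda>x. {x, \<phi> g x}) ` X"
  have Q: "large_scale_structure (orbits G X \<phi>) ?Q"
    using quotient_structure_lss assms by blast
  have A: "large_scale_structure X ?A"
    using action_structure_lss[OF assms(1) group_action_axioms] .
  have orbits: "orbits G X \<phi> = ?q ` X"
    by (auto simp: orbits_def)
  have maps: "?q \<in> X \<rightarrow> orbits G X \<phi>"
    by (auto simp: orbits)
  have gens: "{{{x, \<phi> g x} | x. x \<in> X} | g. g \<in> carrier G} = ?E ` carrier G"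
    by (auto simp: Setcompr_eq_image)
  have A_eq: "?A = generated_structure X (\<X> \<union> ?E ` carrier G)"
    by (simp add: action_structure_def gens)
  have A_sup: "\<X> \<subseteq> ?A" "\<And>g. g \<in> carrier G \<Longrightarrow> ?E g \<in> ?A"
    using generated_structure_superset[of "\<X> \<union> ?E ` carrier G" X] by (auto simp: A_eq)
  \<comment> \<open>By minimality of the generated structure, continuity is tested on generators:
    families in \<open>\<X>\<close> have images in \<open>?Q\<close> by definition, and the pairs
    {x, gx} collapse to singletons.\<close>
  have "?A \<subseteq> {\<U>. \<U> \<subseteq> Pow X \<and> image_family ?q \<U> \<in> ?Q}"
    unfolding A_eq
  proof (rule generated_structure_least[OF large_scale_structure_pullback[OF Q maps]], safe)
    fix \<U> assume U: "\<U> \<in> \<X>"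
    show "image_family ?q \<U> \<in> ?Q"
      using U by (auto simp: quotient_structure_def)
    fix U x assume "U \<in> \<U>" "x \<in> U"
    with lss_subset[OF assms(1) U] show "x \<in> X" by blast
  next
    fix g x assume "g \<in> carrier G" "x \<in> X"
    then show "\<phi> g x \<in> X" using element_image by blast
  next
    fix g assume g: "g \<in> carrier G"
    have "?q (\<phi> g x) = ?q x" if "x \<in> X" for x
      using that g orbit_eq_iff[OF that element_image[OF g that refl]] by blast
    then have "image_family ?q (?E g) = (\<lambda>z. {z}) ` orbits G X \<phi>"
      by (simp add: image_family_eq orbits image_image)
    then show "image_family ?q (?E g) \<in> ?Q"
      using lss_singletons[OF Q] by simp
  qed
  then have cont: "large_scale_continuous X ?A (orbits G X \<phi>) ?Q ?q"
    using A Q maps by (auto simp: large_scale_continuous_def)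
  \<comment> \<open>Since q is onto, the family of singletons already witnesses coarse
    surjectivity.\<close>
  have "orbits G X \<phi> \<subseteq> star (?q ` X) ((\<lambda>z. {z}) ` orbits G X \<phi>)"
    by (auto simp: mem_star orbits)
  then have surj: "coarsely_surjective X ?A (orbits G X \<phi>) ?Q ?q"
    using cont lss_singletons[OF Q] by (auto simp: coarsely_surjective_def)
  have "vimage_family X ?q \<V> \<in> ?A" if "\<V> \<in> ?Q" for \<V>
  proof -
    obtain \<U> where U: "\<U> \<in> \<X>" "\<V> = image_family ?q \<U>"
      using \<open>\<V> \<in> ?Q\<close> by (auto simp: quotient_structure_def)
    \<comment> \<open>All pairs {x, gx} for all g at once; starring with respect to this family
      reaches every translate of every point in one step.\<close>
    let ?F = "\<Union>g\<in>carrier G. ?E g"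
    have F: "?F \<in> ?A"
      by (rule lss_UN[OF A assms(3) A_sup(2)])
    have key: "?q -` ?q ` U \<inter> X \<subseteq> star U ?F" if UU: "U \<in> \<U>" for U
    proof
      fix y assume "y \<in> ?q -` ?q ` U \<inter> X"
      then obtain x where x: "x \<in> U" "?q x = ?q y" "y \<in> X" by auto
      have xX: "x \<in> X" using x UU lss_subset[OF assms(1) U(1)] by auto
      then obtain g where "g \<in> carrier G" "y = \<phi> g x"
        using orbit_eq_iff x by blast
      with x xX show "y \<in> star U ?F"
        \<comment> \<open>The pair contains \<open>y = \<phi> g x\<close> and meets \<open>U\<close>
          in \<open>x\<close>.\<close>
        unfolding mem_star by (intro bexI[of _ "{x, y}"]) auto
    qed
    show ?thesis
    proof (rule lss_refine[OF A lss_star[OF A _ F]])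
      show "\<U> \<in> ?A" using U A_sup by blast
      show "vimage_family X ?q \<V> \<subseteq> Pow X" by (auto simp: vimage_family_eq)
      fix B assume "B \<in> vimage_family X ?q \<V>"
      then obtain U where "U \<in> \<U>" "B = ?q -` ?q ` U \<inter> X"
        by (auto simp: vimage_family_eq U(2) image_family_eq)
      with key[of U] show "\<exists>D\<in>star_family \<U> ?F. B \<subseteq> D"
        by (auto simp: star_family_eq)
    qed
  qed
  with cont surj show ?thesis
    by (auto simp: coarse_equivalence_def coarse_embedding_def)
qed

end
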